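(* Let $d\ge 1$ and let $S\subset M_d(\mathbb{C})$ be a bounded subset with $\rho(S)>0$. Then $$\limsup_{n\to+\infty}\frac{\Lambda(S^n)}{\rho(S)^n}=1.$$
   Context: $M_d(\mathbb{C})$ is the ring of $d\times d$ complex matrices. For $S\subset M_d(\mathbb{C})$ and $n\ge1$, $S^n:=\{s_1\cdots s_n : s_i\in S\}$ is the $n$-fold product set. Given a norm $\|\cdot\|$ on $\mathbb{C}^d$, the same symbol denotes its associated operator norm on $M_d(\mathbb{C})$, and $\|S\|:=\sup_{s\in S}\|s\|$. The joint spectral radius of a bounded set $S$ is $\rho(S):=\lim_{n\to+\infty}\|S^n\|^{1/n}$ (the limit exists and does not depend on the norm). For $s\in M_d(\mathbb{C})$, $\Lambda(s)$ is the largest modulus of an eigenvalue of $s$, and $\Lambda(S):=\sup_{s\in S}\Lambda(s)$. *)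

theory Defs
  imports "HOL-Analysis.Analysis"
begin

text \<open>
  \<^typ>\<open>complex^'d^'d\<close> is the ring of \<open>d \<times> d\<close> complex matrices, with \<open>d = CARD('d) \<ge> 1\<close>.
  Matrix multiplication is \<open>**\<close>; the type class operations \<open>*\<close> and \<open>^\<close> on this type are componentwise
  and are not used.
\<close>

definition set_power :: "(complex^'d^'d) set \<Rightarrow> nat \<Rightarrow> (complex^'d^'d) set" where
  "set_power S n = {foldr (**) ss (mat 1) | ss. length ss = n \<and> set ss \<subseteq> S}"

text \<open>
  In both suprema below the inserted \<open>0\<close> only matters for \<open>S = {}\<close>: it implements the convention
  that the supremum of an empty set of nonnegative numbers is \<open>0\<close>, whereas \<open>Sup {}\<close> is unspecified
  for the reals.
\<close>

definition set_onorm :: "(complex^'d^'d) set \<Rightarrow> real" where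
  "set_onorm S = Sup (insert 0 ((\<lambda>A. onorm ((*v) A)) ` S))"

text \<open>
  The operator norm is the one of the Euclidean norm on \<open>\<complex>\<^sup>d\<close>. The limit exists for bounded \<open>S\<close>, and
  any other norm on \<open>\<complex>\<^sup>d\<close> gives the same value.
\<close>

definition joint_spectral_radius :: "(complex^'d^'d) set \<Rightarrow> real" where
  "joint_spectral_radius S = lim (\<lambda>n. root n (set_onorm (set_power S n)))"

definition eigenvalues :: "complex^'d^'d \<Rightarrow> complex set" where
  "eigenvalues A = {c. \<exists>v. v \<noteq> 0 \<and> A *v v = c *s v}"

definition max_eigenvalue_modulus :: "complex^'d^'d \<Rightarrow> real" where
  "max_eigenvalue_modulus A = Max (cmod ` eigenvalues A)"

definition set_max_eigenvalue_modulus :: "(complex^'d^'d) set \<Rightarrow> real" where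
  "set_max_eigenvalue_modulus S = Sup (insert 0 (max_eigenvalue_modulus ` S))"

end

theory Submission
  imports Defs "HOL-Computational_Algebra.Fundamental_Theorem_Algebra"
begin

text \<open>
  Write \<open>\<rho>\<close> for the joint spectral radius. The upper bound holds since \<open>\<Lambda>(A)\<^sup>k \<le> \<parallel>A\<^sup>k\<parallel> \<le> \<parallel>S\<^sup>k\<^sup>n\<parallel>\<close> for
  \<open>A \<in> S\<^sup>n\<close>. For the lower bound, fix \<open>t > \<rho>\<close>; then \<open>N x = sup \<parallel>A x\<parallel> / t\<^sup>n\<close>, over \<open>n\<close> and \<open>A \<in> S\<^sup>n\<close>, is a norm
  with \<open>N (A x) \<le> t\<^sup>n N x\<close> for \<open>A \<in> S\<^sup>n\<close>, and some product of length \<open>n\<close> expands some vector \<open>x\<close> by at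
  least \<open>\<rho>\<^sup>n / 2\<close>. If \<open>t\<close> is so close to \<open>\<rho>\<close> that \<open>t\<^sup>n \<le> 2 \<rho>\<^sup>n\<close>, all intermediate images of \<open>x\<close>, rescaled
  by powers of \<open>\<rho>\<close>, have \<open>N\<close>-length between \<open>1/4\<close> and \<open>2\<close>. An Auerbach basis of \<open>N\<close> makes \<open>N\<close> comparable to
  the Euclidean norm with a constant depending on \<open>d\<close> only, so for \<open>n\<close> large (chosen before \<open>t\<close>) two
  intermediate images far apart in time are close in space. The subproduct of length \<open>l\<close> between
  them, divided by \<open>\<rho>\<^sup>l\<close>, is conjugate to a bounded matrix that almost fixes a vector of length bounded
  below, hence has an eigenvalue near \<open>1\<close>. Choosing the norm anew for each \<open>t\<close> avoids
  any reduction to irreducible \<open>S\<close>.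
\<close>

section \<open>Eigenvalues\<close>

text \<open>In the Leibniz expansion with polynomial entries, only diagonal entries are
  non-constant. The degree of the term of a permutation is thus at most its number of fixed points,
  and only the identity reaches degree \<open>CARD('n)\<close>.\<close>

lemma det_pencil_monic:
  fixes A :: "'a::idom^'n^'n"
  obtains p where "lead_coeff p = 1" "degree p = CARD('n)" "\<And>x. poly p x = det (mat x - A)"
proof -
  define M where "M i j = [:- A $ i $ j, if i = j then 1 else 0:]" for i j
  define f where "f \<sigma> = of_int (sign \<sigma>) * (\<Prod>i\<in>UNIV. M i (\<sigma> i))" for \<sigma>
  define p where "p = (\<Sum>\<sigma> | \<sigma> permutes UNIV. f \<sigma>)"
  have deg_M: "degree (M i j) = (if i = j then 1 else 0)" for i j
    by (simp add: M_def)
  have coeff_M: "coeff (M i i) 1 = 1" for i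
    by (simp add: M_def)
  have deg_f: "degree (f \<sigma>) \<le> card {i. \<sigma> i = i}" for \<sigma>
  proof -
    have "degree (f \<sigma>) \<le> degree (of_int (sign \<sigma>) :: 'a poly) + degree (\<Prod>i\<in>UNIV. M i (\<sigma> i))"
      unfolding f_def by (rule degree_mult_le)
    also have "degree (of_int (sign \<sigma>) :: 'a poly) = 0"
      by simp
    also have "degree (\<Prod>i\<in>UNIV. M i (\<sigma> i)) \<le> (\<Sum>i\<in>UNIV. degree (M i (\<sigma> i)))"
      using degree_prod_sum_le[of UNIV "\<lambda>i. M i (\<sigma> i)"] by (simp add: o_def)
    also have "\<dots> = (\<Sum>i\<in>UNIV. if \<sigma> i = i then 1 else 0)"
      by (intro sum.cong) (auto simp: deg_M)
    also have "\<dots> = card {i. \<sigma> i = i}"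
      by (simp add: sum.If_cases)
    finally show ?thesis by simp
  qed
  have monic_prod: "lead_coeff (\<Prod>i\<in>I. M i i) = 1" for I
    by (induction I rule: infinite_finite_induct) (simp_all add: lead_coeff_mult deg_M coeff_M[simplified])
  have deg_prod: "degree (\<Prod>i\<in>I. M i i) = card I" for I
    by (subst degree_prod_sum_eq) (auto simp: M_def)
  have lead_id: "coeff (f id) CARD('n) = 1"
    using monic_prod[of UNIV] by (simp add: f_def sign_id deg_prod)
  have lead_other: "coeff (f \<sigma>) CARD('n) = 0" if "\<sigma> \<noteq> id" for \<sigma>
  proof -
    have "{i. \<sigma> i = i} \<subset> UNIV" using that by (auto simp: fun_eq_iff)
    hence "card {i. \<sigma> i = i} < CARD('n)" by (rule psubset_card_mono[rotated]) simp
    thus ?thesis using deg_f[of \<sigma>] by (intro coeff_eq_0) simp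
  qed
  have "coeff p CARD('n) = (\<Sum>\<sigma> | \<sigma> permutes (UNIV :: 'n set). if \<sigma> = id then 1 else 0)"
    unfolding p_def coeff_sum by (intro sum.cong) (auto simp: lead_id lead_other)
  also have "\<dots> = 1"
    by (simp add: finite_permutations permutes_id)
  finally have coeff_p: "coeff p CARD('n) = 1" .
  have "degree (f \<sigma>) \<le> CARD('n)" for \<sigma>
    using deg_f[of \<sigma>] card_mono[of UNIV "{i. \<sigma> i = i}"] by simp
  hence "degree p \<le> CARD('n)"
    unfolding p_def by (intro degree_sum_le) (auto simp: finite_permutations)
  hence deg_p: "degree p = CARD('n)"
    using coeff_p le_degree[of p "CARD('n)"] by simp
  have "poly p x = det (mat x - A)" for x
  proof -
    have "poly (of_int k :: 'a poly) x = of_int k" for k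
      by (cases k) auto
    thus ?thesis
      unfolding p_def f_def det_def poly_sum
      by (auto simp: poly_prod M_def mat_def intro!: sum.cong prod.cong)
  qed
  thus ?thesis using that coeff_p deg_p by metis
qed

lemma mat_vector_mult: "mat c *v x = c *s (x :: 'a::semiring_1^'n)"
  by (simp add: mat_def matrix_vector_mult_def vec_eq_iff if_distrib if_distribR cong: if_cong)

lemma eigenvalues_iff_det: "c \<in> eigenvalues A \<longleftrightarrow> det (mat c - A) = 0"
proof -
  have "(mat c - A) *v v = c *s v - A *v v" for v
    by (simp add: matrix_vector_mult_diff_rdistrib mat_vector_mult)
  hence "c \<in> eigenvalues A \<longleftrightarrow> (\<exists>v. v \<noteq> 0 \<and> (mat c - A) *v v = 0)"
    by (auto simp: eigenvalues_def)
  also have "\<dots> \<longleftrightarrow> \<not> invertible (mat c - A)"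
    by (metis invertible_left_inverse matrix_left_invertible_ker)
  finally show ?thesis by (simp add: invertible_det_nz)
qed

text \<open>Listing the roots with multiplicity gives exactly \<open>CARD('d)\<close> factors, so a
  common lower bound on all distances from \<open>x\<close> to the eigenvalues turns into a lower
  bound on the determinant.\<close>

lemma det_pencil_factorization:
  fixes A :: "complex^'d^'d"
  obtains root where "\<And>x. det (mat x - A) = (\<Prod>i<CARD('d). x - root i)"
    "eigenvalues A = root ` {..<CARD('d)}"
proof -
  obtain p where p: "lead_coeff p = 1" "degree p = CARD('d)" "\<And>x. poly p x = det (mat x - A)"
    using det_pencil_monic[of A] by blast
  obtain root where "smult (lead_coeff p) (\<Prod>i<degree p. [:- root i, 1:]) = p"
    using complex_poly_decompose' by blast
  hence "p = (\<Prod>i<CARD('d). [:- root i, 1:])"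
    using p by simp
  hence *: "det (mat x - A) = (\<Prod>i<CARD('d). x - root i)" for x
    by (simp add: p(3)[symmetric] poly_prod)
  show ?thesis
    by (rule that[OF *]) (auto simp: eigenvalues_iff_det *)
qed

lemma eigenvalues_finite: "finite (eigenvalues A)"
  by (rule det_pencil_factorization[of A]) auto

lemma eigenvalues_nonempty: "eigenvalues (A :: complex^'d^'d) \<noteq> {}"
  by (rule det_pencil_factorization[of A]) (auto simp: lessThan_empty_iff)

lemma cmod_le_max_eigenvalue_modulus:
  "c \<in> eigenvalues A \<Longrightarrow> cmod c \<le> max_eigenvalue_modulus A"
  unfolding max_eigenvalue_modulus_def by (intro Max_ge) (auto simp: eigenvalues_finite)

lemma max_eigenvalue_modulus_attained:
  obtains c where "c \<in> eigenvalues A" "max_eigenvalue_modulus A = cmod c"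
proof -
  have "max_eigenvalue_modulus A \<in> cmod ` eigenvalues A"
    unfolding max_eigenvalue_modulus_def
    by (intro Max_in) (auto simp: eigenvalues_finite eigenvalues_nonempty)
  thus ?thesis using that by auto
qed

section \<open>Compact sets of matrices and eigenvalues near 1\<close>

lemma continuous_on_det [continuous_intros]:
  fixes f :: "'a::topological_space \<Rightarrow> 'b::{real_normed_field}^'n^'n"
  assumes "continuous_on X f"
  shows "continuous_on X (\<lambda>x. det (f x))"
  unfolding det_def using assms by (intro continuous_intros)

lemma compact_bounded_entries:
  "compact {A :: 'a::{heine_borel,real_normed_vector}^'n^'m. \<forall>i j. norm (A $ i $ j) \<le> K}"
proof -
  have "norm A \<le> (\<Sum>i\<in>(UNIV::'m set). \<Sum>j\<in>(UNIV::'n set). K)"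
    if "\<forall>i j. norm (A $ i $ j) \<le> K" for A :: "'a^'n^'m"
  proof -
    have "norm A \<le> (\<Sum>i\<in>UNIV. norm (A $ i))"
      unfolding norm_vec_def by (rule L2_set_le_sum) auto
    also have "\<dots> \<le> (\<Sum>i\<in>UNIV. \<Sum>j\<in>UNIV. norm (A $ i $ j))"
      unfolding norm_vec_def[of "A $ _"] by (intro sum_mono L2_set_le_sum) auto
    also have "\<dots> \<le> (\<Sum>i\<in>(UNIV::'m set). \<Sum>j\<in>(UNIV::'n set). K)"
      using that by (intro sum_mono) auto
    finally show ?thesis .
  qed
  hence "bounded {A :: 'a^'n^'m. \<forall>i j. norm (A $ i $ j) \<le> K}"
    unfolding bounded_iff by blast
  moreover have "closed {A :: 'a^'n^'m. \<forall>i j. norm (A $ i $ j) \<le> K}"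
    by (intro closed_Collect_all closed_Collect_le continuous_intros)
  ultimately show ?thesis by (simp add: compact_eq_bounded_closed)
qed

lemma continuous_on_matrix_vector_mult [continuous_intros]:
  fixes f :: "'a::topological_space \<Rightarrow> 'b::real_normed_algebra_1^'n^'m"
  assumes "continuous_on X f" "continuous_on X g"
  shows "continuous_on X (\<lambda>x. f x *v g x)"
  unfolding matrix_vector_mult_def using assms by (intro continuous_intros)

text \<open>On the compact set of pairs \<open>(A, x)\<close> for which \<open>A\<close> stays away
  from having eigenvalue 1, the continuous quantity \<open>norm (A *v x - x)\<close> has a positive
  minimum, which serves as \<epsilon>. Hence \<epsilon> depends only on the dimension and the four
  constants.\<close>

lemma eigenvalue_near_one:
  fixes K c C \<eta> :: real
  assumes "c > 0" "\<eta> > 0"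
  obtains \<epsilon> where "\<epsilon> > 0"
    "\<And>A (x :: complex^'d). \<lbrakk>\<And>i j. cmod (A $ i $ j) \<le> K; c \<le> norm x; norm x \<le> C; norm (A *v x - x) < \<epsilon>\<rbrakk>
       \<Longrightarrow> \<exists>\<mu>\<in>eigenvalues A. cmod (\<mu> - 1) < \<eta>"
proof -
  \<comment> \<open>The determinant condition follows when all eigenvalues have distance at least
    \<eta> from 1, it is visibly closed, and it still excludes 1 as an eigenvalue.\<close>
  define D where "D = ({A :: complex^'d^'d. \<forall>i j. cmod (A $ i $ j) \<le> K} \<times> {x :: complex^'d. c \<le> norm x \<and> norm x \<le> C})
    \<inter> {z. \<eta> ^ CARD('d) \<le> cmod (det (mat 1 - fst z))}"
  have far: "(A, x) \<in> D" if "\<And>i j. cmod (A $ i $ j) \<le> K" "c \<le> norm x" "norm x \<le> C"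
    "\<not> (\<exists>\<mu>\<in>eigenvalues A. cmod (\<mu> - 1) < \<eta>)" for A x
  proof -
    obtain root where root: "\<And>x. det (mat x - A) = (\<Prod>i<CARD('d). x - root i)"
      "eigenvalues A = root ` {..<CARD('d)}"
      using det_pencil_factorization[of A] by blast
    have "(\<Prod>i<CARD('d). \<eta>) \<le> (\<Prod>i<CARD('d). cmod (1 - root i))"
      using that(4) assms(2) by (intro prod_mono) (auto simp: root(2) norm_minus_commute not_less)
    thus ?thesis using that by (simp add: D_def root(1) prod_norm)
  qed
  have "compact {x :: complex^'d. c \<le> norm x \<and> norm x \<le> C}"
    unfolding compact_eq_bounded_closed
    by (intro conjI closed_Collect_conj closed_Collect_le continuous_intros) (auto simp: bounded_iff)
  moreover have "closed {z :: (complex^'d^'d) \<times> (complex^'d). \<eta> ^ CARD('d) \<le> cmod (det (mat 1 - fst z))}"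
    by (intro closed_Collect_le continuous_intros)
  ultimately have "compact D"
    unfolding D_def by (intro compact_Int_closed compact_Times compact_bounded_entries)
  have pos: "norm (fst z *v snd z - snd z) > 0" if "z \<in> D" for z
  proof (rule ccontr)
    assume "\<not> ?thesis"
    hence "fst z *v snd z = 1 *s snd z" by simp
    moreover have "snd z \<noteq> 0" using that assms(1) by (auto simp: D_def)
    ultimately have "1 \<in> eigenvalues (fst z)" unfolding eigenvalues_def by blast
    moreover have "\<eta> ^ CARD('d) > 0" using assms(2) by simp
    ultimately show False using that by (auto simp: D_def eigenvalues_iff_det)
  qed
  show ?thesis
  proof (cases "D = {}")
    case True
    thus ?thesis using far that[of 1] by fastforce
  next
    case False
    have "continuous_on D (\<lambda>z. norm (fst z *v snd z - snd z))"
      by (intro continuous_intros)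
    then obtain z where z: "z \<in> D" "\<And>y. y \<in> D \<Longrightarrow> norm (fst z *v snd z - snd z) \<le> norm (fst y *v snd y - snd y)"
      using continuous_attains_inf[OF \<open>compact D\<close> False] by blast
    show ?thesis
      using that[OF pos[OF z(1)]] far z(2) by (metis fst_conv snd_conv not_le)
  qed
qed

section \<open>Submultiplicative sequences and compactness\<close>

text \<open>Fekete's lemma in multiplicative form, stated with roots instead of logarithms because
  \<open>a\<close> may vanish. If \<open>a m\<close> is at most \<open>u ^ m\<close> for one
  \<open>m\<close>, division with remainder by \<open>m\<close> yields the rate \<open>u\<close> for
  all \<open>n\<close> up to a constant.\<close>

lemma submultiplicative_growth:
  fixes a :: "nat \<Rightarrow> real"
  assumes nonneg: "\<And>n. a n \<ge> 0" and submult: "\<And>m n. a (m + n) \<le> a m * a n"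
  obtains L where "(\<lambda>n. root n (a n)) \<longlonglongrightarrow> L" "L \<ge> 0" "\<And>n. L ^ n \<le> a n \<or> n = 0"
    "\<And>t. L < t \<Longrightarrow> \<exists>C. \<forall>n. a n \<le> C * t ^ n"
proof -
  \<comment> \<open>The index 0 is left out because \<open>root 0\<close> is constantly 0.\<close>
  define L where "L = (INF n\<in>{1..}. root n (a n))"
  have bdd: "bdd_below ((\<lambda>n. root n (a n)) ` {1..})"
    using nonneg by (intro bdd_belowI[of _ 0]) auto
  have L_le: "L \<le> root n (a n)" if "n \<ge> 1" for n
    unfolding L_def using that by (intro cINF_lower bdd) auto
  have "L \<ge> 0"
    unfolding L_def using nonneg by (intro cINF_greatest) auto
  have L_pow: "L ^ n \<le> a n" if "n \<ge> 1" for n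
    using power_mono[OF L_le[OF that] \<open>L \<ge> 0\<close>, of n] that nonneg by simp
  have growth: "\<exists>C>0. \<forall>n. a n \<le> C * u ^ n" if "L < u" for u :: real
  proof -
    obtain m where m: "m \<ge> 1" "root m (a m) < u"
      using \<open>L < u\<close> cINF_less_iff[OF _ bdd, of u] by (auto simp: L_def)
    have "u > 0" using that \<open>L \<ge> 0\<close> by simp
    have am: "a m \<le> u ^ m"
    proof -
      have "a m = root m (a m) ^ m" using m(1) nonneg by simp
      also have "\<dots> \<le> u ^ m" using m nonneg by (intro power_mono) auto
      finally show ?thesis .
    qed
    have multiples: "a (m * q + r) \<le> (u ^ m) ^ q * a r" for q r
    proof (induction q)
      case (Suc q)
      have "a (m * Suc q + r) = a (m + (m * q + r))" by (simp add: algebra_simps)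
      also have "\<dots> \<le> a m * a (m * q + r)" by (rule submult)
      also have "\<dots> \<le> u ^ m * ((u ^ m) ^ q * a r)"
        using am Suc \<open>u > 0\<close> nonneg by (intro mult_mono) auto
      finally show ?case by (simp add: mult.assoc)
    qed simp
    \<comment> \<open>The sum covers every possible remainder modulo \<open>m\<close>; the added 1
      keeps \<open>C\<close> positive, as needed for \<open>root n C\<close> to tend to 1.\<close>
    define C where "C = 1 + (\<Sum>r<m. a r / u ^ r)"
    have "C > 0" unfolding C_def using nonneg \<open>u > 0\<close> by (intro add_pos_nonneg sum_nonneg) auto
    have bound: "a n \<le> C * u ^ n" for n
    proof -
      have "a n \<le> (u ^ m) ^ (n div m) * a (n mod m)"
        using multiples[of "n div m" "n mod m"] by simp
      also have "\<dots> = u ^ (m * (n div m) + n mod m) * (a (n mod m) / u ^ (n mod m))"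
        using \<open>u > 0\<close> unfolding power_add power_mult by simp
      also have "\<dots> = u ^ n * (a (n mod m) / u ^ (n mod m))"
        by simp
      also have "a (n mod m) / u ^ (n mod m) \<le> (\<Sum>r<m. a r / u ^ r)"
        using m(1) nonneg \<open>u > 0\<close> by (intro member_le_sum) auto
      hence "u ^ n * (a (n mod m) / u ^ (n mod m)) \<le> u ^ n * C"
        unfolding C_def using \<open>u > 0\<close> by (intro mult_left_mono) auto
      finally show ?thesis by (simp add: mult.commute)
    qed
    thus ?thesis using \<open>C > 0\<close> by blast
  qed
  have above: "\<forall>\<^sub>F n in sequentially. root n (a n) < t" if "L < t" for t
  proof -
    \<comment> \<open>A rate strictly below \<open>t\<close> leaves room for the factor
      \<open>root n C\<close>.\<close>
    define u where "u = (L + t) / 2"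
    have u: "L < u" "u < t" using that by (simp_all add: u_def)
    hence "u > 0" using \<open>L \<ge> 0\<close> by simp
    obtain C where C: "C > 0" "\<And>n. a n \<le> C * u ^ n"
      using growth[OF u(1)] by blast
    have "(\<lambda>n. root n C * u) \<longlonglongrightarrow> 1 * u"
      using \<open>C > 0\<close> by (intro tendsto_intros LIMSEQ_root_const)
    hence "\<forall>\<^sub>F n in sequentially. root n C * u < t"
      using u(2) by (intro order_tendstoD) auto
    thus ?thesis
      using eventually_gt_at_top[of 0]
    proof eventually_elim
      case (elim n)
      have "root n (a n) \<le> root n (C * u ^ n)" using C(2) elim(2) by simp
      also have "\<dots> = root n C * u" using elim(2) \<open>u > 0\<close> by (simp add: real_root_mult real_root_power_cancel)
      finally show ?case using elim(1) by simp
    qed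
  qed
  have "(\<lambda>n. root n (a n)) \<longlonglongrightarrow> L"
  proof (rule order_tendstoI)
    fix t assume "t < L"
    have "\<forall>\<^sub>F n in sequentially. n \<ge> 1" by (rule eventually_ge_at_top)
    thus "\<forall>\<^sub>F n in sequentially. t < root n (a n)"
      by eventually_elim (use L_le \<open>t < L\<close> in \<open>force intro: less_le_trans\<close>)
  qed (use above in auto)
  thus ?thesis using that \<open>L \<ge> 0\<close> L_pow growth by (metis less_one not_le)
qed

text \<open>Among \<open>card F + 1\<close> points, two share a centre of a finite \<epsilon>/2-net
  \<open>F\<close>. The bound \<open>M\<close> is uniform in the sequence, so a product length can
  be fixed before the points are known.\<close>

lemma compact_pigeonhole:
  fixes K :: "'a::metric_space set"
  assumes "compact K" "\<epsilon> > 0"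
  shows "\<exists>M :: nat. \<forall>x. (\<forall>i\<le>M. x i \<in> K) \<longrightarrow> (\<exists>i j. i < j \<and> j \<le> M \<and> dist (x i) (x j) < \<epsilon>)"
proof -
  obtain F where F: "finite F" "K \<subseteq> (\<Union>y\<in>F. ball y (\<epsilon> / 2))"
    using assms seq_compact_imp_totally_bounded[of K] by (metis compact_eq_seq_compact_metric half_gt_zero)
  show ?thesis
  proof (rule exI[of _ "card F"], intro allI impI)
    fix x :: "nat \<Rightarrow> 'a" assume x: "\<forall>i\<le>card F. x i \<in> K"
    hence "\<exists>y\<in>F. dist y (x i) < \<epsilon> / 2" if "i \<le> card F" for i
      using F(2) that by fastforce
    then obtain c where c: "\<And>i. i \<le> card F \<Longrightarrow> c i \<in> F \<and> dist (c i) (x i) < \<epsilon> / 2"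
      by metis
    have "c ` {..card F} \<subseteq> F" using c by auto
    hence "card (c ` {..card F}) < card {..card F}"
      using card_mono[OF F(1)] by (simp add: le_imp_less_Suc)
    hence "\<not> inj_on c {..card F}" by (rule pigeonhole)
    then obtain i j where "i \<le> card F" "j \<le> card F" "i < j" "c i = c j"
      unfolding inj_on_def by (metis atMost_iff linorder_neqE_nat)
    thus "\<exists>i j. i < j \<and> j \<le> card F \<and> dist (x i) (x j) < \<epsilon>"
      using c[of i] c[of j] dist_triangle_half_r by (metis dist_commute)
  qed
qed

section \<open>Auerbach bases\<close>

lemma norm_vector_smult: "norm (c *s (x :: complex^'d)) = cmod c * norm x"
  by (simp add: norm_vec_def norm_mult L2_set_right_distrib)

lemma norm_axis: "norm (axis i (x :: 'a::real_inner) :: 'a^'n) = norm x"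
  by (simp add: norm_eq_sqrt_inner inner_axis_axis)

text \<open>
  For the vectors of the unit ball of \<open>N\<close> spanning the largest volume, Cramer's rule
  bounds the coordinates of any vector by its \<open>N\<close>-length.
\<close>
lemma auerbach_basis:
  fixes N :: "complex^'d \<Rightarrow> real"
  assumes triangle: "\<And>x y. N (x + y) \<le> N x + N y"
    and homogeneous: "\<And>c x. N (c *s x) = cmod c * N x"
    and lower: "\<And>x. norm x \<le> N x" and upper: "\<And>x. N x \<le> C * norm x"
  shows "\<exists>B :: complex^'d^'d. invertible B \<and> (\<forall>x. N (B *v x) \<le> CARD('d) * norm x) \<and> (\<forall>x. norm x \<le> CARD('d) * N (B *v x))"
proof -
  have N_zero: "N 0 = 0" using homogeneous[of 0 0] by simp
  have N_pos: "N x > 0" if "x \<noteq> 0" for x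
    using lower[of x] that by (meson less_le_trans zero_less_norm_iff)
  have C_nonneg: "C \<ge> 0"
    using lower[of "axis undefined 1"] upper[of "axis undefined 1"] by (simp add: norm_axis)
  have N_diff: "\<bar>N x - N y\<bar> \<le> C * norm (x - y)" for x y
    using triangle[of "x - y" y] triangle[of "y - x" x] upper[of "x - y"] upper[of "y - x"]
    by (simp add: norm_minus_commute)
  have "C-lipschitz_on UNIV N"
    using N_diff C_nonneg by (auto simp: lipschitz_on_def dist_norm)
  hence cont: "continuous_on UNIV N" by (rule lipschitz_on_continuous_on)
  have N_sum: "N (\<Sum>i\<in>I. f i) \<le> (\<Sum>i\<in>I. N (f i))" for I :: "'d set" and f
    by (induction I rule: infinite_finite_induct) (auto simp: N_zero intro: order_trans[OF triangle])

  \<comment> \<open>The matrices whose columns lie in the unit ball of \<open>N\<close>;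
    \<open>X\<close> is compact because \<open>N\<close> is continuous and dominates the Euclidean
    norm.\<close>
  define X where "X = {A :: complex^'d^'d. \<forall>j. N (column j A) \<le> 1}"
  have "X \<subseteq> {A. \<forall>i j. cmod (A $ i $ j) \<le> 1}"
  proof (clarsimp simp: X_def)
    fix A :: "complex^'d^'d" and i j assume *: "\<forall>j. N (column j A) \<le> 1"
    have "cmod (A $ i $ j) \<le> norm (column j A)"
      using Finite_Cartesian_Product.norm_nth_le[of "column j A" i] by (simp add: column_def)
    also have "\<dots> \<le> 1" using lower[of "column j A"] * by (meson order_trans)
    finally show "cmod (A $ i $ j) \<le> 1" .
  qed
  moreover have "closed X"
  proof -
    have "continuous_on UNIV (\<lambda>A :: complex^'d^'d. N (column j A))" for j
      unfolding column_def
      by (rule continuous_on_compose2[OF cont]) (auto intro!: continuous_intros)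
    thus ?thesis unfolding X_def
      by (intro closed_Collect_all closed_Collect_le) auto
  qed
  ultimately have "compact X"
    using compact_bounded_entries[of 1] compact_Int_closed[of "{A. \<forall>i j. cmod (A $ i $ j) \<le> 1}" X]
    by (simp add: Int_absorb1)
  \<comment> \<open>A small scalar matrix in \<open>X\<close> shows that the maximal determinant is
    nonzero.\<close>
  define \<alpha> where "\<alpha> = 1 / (C + 1)"
  have "\<alpha> > 0" unfolding \<alpha>_def using C_nonneg by simp
  have "mat (of_real \<alpha>) \<in> X"
  proof -
    have "column j (mat (of_real \<alpha>)) = of_real \<alpha> *s (axis j 1 :: complex^'d)" for j :: 'd
      by (simp add: column_def mat_def axis_def vec_eq_iff)
    moreover have "\<alpha> * N (axis j 1) \<le> 1" for j :: 'd
      using upper[of "axis j 1"] C_nonneg by (simp add: \<alpha>_def norm_axis divide_simps)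
    ultimately show ?thesis using \<open>\<alpha> > 0\<close> by (simp add: X_def homogeneous)
  qed
  moreover have "continuous_on X (\<lambda>A. cmod (det A))" by (intro continuous_intros)
  ultimately obtain B where B: "B \<in> X" "\<And>A. A \<in> X \<Longrightarrow> cmod (det A) \<le> cmod (det B)"
    using continuous_attains_sup[OF \<open>compact X\<close>] by blast
  have "cmod (det (mat (of_real \<alpha>) :: complex^'d^'d)) > 0"
    using \<open>\<alpha> > 0\<close> by (subst det_diagonal) (auto simp: mat_def)
  hence det_B: "cmod (det B) > 0" using B(2) \<open>mat (of_real \<alpha>) \<in> X\<close> by fastforce
  have coord: "cmod (x $ k) \<le> N (B *v x)" for x k
  proof (cases "x = 0")
    case False
    have "invertible B" using det_B by (auto simp: invertible_det_nz)
    hence "B *v x \<noteq> 0" using False by (metis invertible_def matrix_left_invertible_ker)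
    hence pos: "N (B *v x) > 0" by (rule N_pos)
    \<comment> \<open>After normalisation, replacing column \<open>k\<close> of \<open>B\<close> by
      \<open>B *v y\<close> stays in \<open>X\<close> and multiplies the determinant by
      \<open>y $ k\<close>; maximality of \<open>B\<close> forces this factor to have modulus at
      most 1.\<close>
    define y where "y = of_real (1 / N (B *v x)) *s x"
    have By: "B *v y = of_real (1 / N (B *v x)) *s (B *v x)"
      unfolding y_def by (rule vec.scale)
    have "N (B *v y) = 1" using pos unfolding By homogeneous by (simp add: norm_divide)
    define A where "A = (\<chi> i j. if j = k then (B *v y) $ i else B $ i $ j)"
    have "column j A = (if j = k then B *v y else column j B)" for j
      by (simp add: A_def column_def vec_eq_iff)
    hence "A \<in> X" using B(1) \<open>N (B *v y) = 1\<close> by (simp add: X_def)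
    hence "cmod (y $ k * det B) \<le> cmod (det B)"
      using B(2)[of A] cramer_lemma[of k B y] by (simp add: A_def)
    hence "cmod (y $ k) \<le> 1" using det_B by (simp add: norm_mult)
    thus ?thesis using pos by (simp add: y_def norm_mult norm_divide divide_simps)
  qed (simp add: N_zero)
  show ?thesis
  proof (intro exI[of _ B] conjI allI)
    show "invertible B" using det_B by (auto simp: invertible_det_nz)
  next
    fix x :: "complex^'d"
    have "N (B *v x) = N (\<Sum>i\<in>UNIV. x $ i *s column i B)"
      by (simp add: matrix_mult_sum)
    also have "\<dots> \<le> (\<Sum>i\<in>UNIV. cmod (x $ i) * N (column i B))"
      using N_sum[of "\<lambda>i. x $ i *s column i B" UNIV] by (simp add: homogeneous)
    also have "\<dots> \<le> (\<Sum>i\<in>(UNIV::'d set). norm x * 1)"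
      using B(1) lower Finite_Cartesian_Product.norm_nth_le[of x]
      by (intro sum_mono mult_mono) (auto simp: X_def intro: order_trans[OF norm_ge_zero])
    finally show "N (B *v x) \<le> CARD('d) * norm x" by simp
  next
    fix x :: "complex^'d"
    have "norm x \<le> (\<Sum>i\<in>UNIV. cmod (x $ i))"
      unfolding norm_vec_def by (rule L2_set_le_sum) auto
    also have "\<dots> \<le> (\<Sum>i\<in>(UNIV::'d set). N (B *v x))"
      using coord by (rule sum_mono)
    finally show "norm x \<le> CARD('d) * N (B *v x)" by simp
  qed
qed

section \<open>The joint spectral radius\<close>

lemma foldr_matrix_mult_append:
  "foldr (**) (xs @ ys) (mat 1) = foldr (**) xs (mat 1) ** foldr (**) ys (mat 1 :: 'a::semiring_1^'n^'n)"
  by (induction xs) (auto simp: matrix_mul_assoc)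

lemma set_power_0: "set_power S 0 = {mat 1}"
  by (auto simp: set_power_def)

lemma set_power_addI:
  "A \<in> set_power S m \<Longrightarrow> B \<in> set_power S n \<Longrightarrow> A ** B \<in> set_power S (m + n)"
proof -
  assume "A \<in> set_power S m" "B \<in> set_power S n"
  then obtain ss ts where "A = foldr (**) ss (mat 1)" "length ss = m" "set ss \<subseteq> S"
    "B = foldr (**) ts (mat 1)" "length ts = n" "set ts \<subseteq> S"
    by (auto simp: set_power_def)
  thus "A ** B \<in> set_power S (m + n)"
    unfolding set_power_def mem_Collect_eq
    by (intro exI[of _ "ss @ ts"]) (simp add: foldr_matrix_mult_append del: foldr_append)
qed

lemma set_power_addE:
  assumes "A \<in> set_power S (m + n)"
  obtains B C where "B \<in> set_power S m" "C \<in> set_power S n" "A = B ** C"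
proof -
  obtain ss where ss: "A = foldr (**) ss (mat 1)" "length ss = m + n" "set ss \<subseteq> S"
    using assms by (auto simp: set_power_def)
  show ?thesis
  proof
    show "foldr (**) (take m ss) (mat 1) \<in> set_power S m"
      using ss set_take_subset[of m ss] by (force simp: set_power_def)
    show "foldr (**) (drop m ss) (mat 1) \<in> set_power S n"
      using ss set_drop_subset[of m ss] by (force simp: set_power_def)
    show "A = foldr (**) (take m ss) (mat 1) ** foldr (**) (drop m ss) (mat 1)"
      by (simp add: foldr_matrix_mult_append[symmetric] ss)
  qed
qed

lemma onorm_matrix_mult_le:
  "onorm ((*v) (A ** B)) \<le> onorm ((*v) A) * onorm ((*v) (B :: complex^'n^'n))"
  using onorm_compose[of "(*v) A" "(*v) B"] by (simp add: o_def matrix_vector_mul_assoc)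

text \<open>A crude exponential bound, which makes the suprema in \<open>set_onorm\<close>
  finite.\<close>

lemma onorm_set_power_bounded:
  fixes S :: "(complex^'d^'d) set"
  assumes "bounded S"
  obtains K where "K \<ge> 0" "\<And>n A. A \<in> set_power S n \<Longrightarrow> onorm ((*v) A) \<le> K ^ n"
proof -
  obtain k where k: "\<And>A. A \<in> S \<Longrightarrow> norm A \<le> k"
    using assms by (auto simp: bounded_iff)
  define K where "K = (\<Sum>i\<in>(UNIV::'d set). \<Sum>j\<in>(UNIV::'d set). \<bar>k\<bar>)"
  have K: "onorm ((*v) A) \<le> K" if "A \<in> S" for A
  proof (rule onorm_le)
    fix x
    have entry: "cmod (A $ i $ j) \<le> \<bar>k\<bar>" for i j
      using k[OF that] Finite_Cartesian_Product.norm_nth_le[of A i]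
        Finite_Cartesian_Product.norm_nth_le[of "A $ i" j] by linarith
    have "norm (A *v x) \<le> (\<Sum>i\<in>UNIV. cmod ((A *v x) $ i))"
      unfolding norm_vec_def by (rule L2_set_le_sum) auto
    also have "\<dots> \<le> (\<Sum>i\<in>(UNIV::'d set). \<Sum>j\<in>(UNIV::'d set). \<bar>k\<bar> * norm x)"
    proof (rule sum_mono)
      fix i
      have "cmod ((A *v x) $ i) \<le> (\<Sum>j\<in>UNIV. cmod (A $ i $ j) * cmod (x $ j))"
        unfolding matrix_vector_mult_def by (auto intro: order_trans[OF norm_sum] simp: norm_mult)
      also have "\<dots> \<le> (\<Sum>j\<in>(UNIV::'d set). \<bar>k\<bar> * norm x)"
        using entry Finite_Cartesian_Product.norm_nth_le[of x] by (intro sum_mono mult_mono) auto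
      finally show "cmod ((A *v x) $ i) \<le> (\<Sum>j\<in>(UNIV::'d set). \<bar>k\<bar> * norm x)" .
    qed
    finally show "norm (A *v x) \<le> K * norm x"
      by (simp add: K_def)
  qed
  have "K \<ge> 0" by (simp add: K_def)
  have "onorm ((*v) A) \<le> K ^ n" if "A \<in> set_power S n" for n A
    using that
  proof (induction n arbitrary: A)
    case 0
    thus ?case by (simp add: set_power_0 onorm_id_le)
  next
    case (Suc n)
    then obtain ss where "A = foldr (**) ss (mat 1)" "length ss = Suc n" "set ss \<subseteq> S"
      by (auto simp: set_power_def)
    then obtain s ss' where *: "A = s ** foldr (**) ss' (mat 1)" "s \<in> S" "length ss' = n" "set ss' \<subseteq> S"
      by (cases ss) auto
    hence "foldr (**) ss' (mat 1) \<in> set_power S n" by (auto simp: set_power_def)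
    hence "onorm ((*v) s) * onorm ((*v) (foldr (**) ss' (mat 1))) \<le> K * K ^ n"
      using K * Suc.IH \<open>K \<ge> 0\<close> by (intro mult_mono onorm_pos_le) auto
    thus ?case using onorm_matrix_mult_le[of s "foldr (**) ss' (mat 1)"] * by simp
  qed
  thus ?thesis using that \<open>K \<ge> 0\<close> by blast
qed

lemma bdd_above_onorm_set_power:
  assumes "bounded S"
  shows "bdd_above (insert 0 ((\<lambda>A. onorm ((*v) A)) ` set_power S n))"
proof -
  obtain K where "K \<ge> 0" "\<And>n A. A \<in> set_power S n \<Longrightarrow> onorm ((*v) A) \<le> K ^ n"
    using onorm_set_power_bounded[OF assms] by blast
  thus ?thesis by (intro bdd_aboveI[of _ "K ^ n"]) auto
qed

lemma onorm_le_set_onorm: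
  assumes "bounded S" "A \<in> set_power S n"
  shows "onorm ((*v) A) \<le> set_onorm (set_power S n)"
  unfolding set_onorm_def using assms by (intro cSup_upper bdd_above_onorm_set_power) auto

lemma set_onorm_set_power_nonneg: "bounded S \<Longrightarrow> 0 \<le> set_onorm (set_power S n)"
  unfolding set_onorm_def by (intro cSup_upper bdd_above_onorm_set_power) auto

lemma set_onorm_set_power_submult:
  fixes S :: "(complex^'d^'d) set"
  assumes "bounded S"
  shows "set_onorm (set_power S (m + n)) \<le> set_onorm (set_power S m) * set_onorm (set_power S n)"
proof -
  have "onorm ((*v) A) \<le> set_onorm (set_power S m) * set_onorm (set_power S n)"
    if A: "A \<in> set_power S (m + n)" for A
  proof -
    obtain B C where BC: "B \<in> set_power S m" "C \<in> set_power S n" "A = B ** C"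
      using set_power_addE[OF A] by blast
    have "onorm ((*v) A) \<le> onorm ((*v) B) * onorm ((*v) C)"
      unfolding BC by (rule onorm_matrix_mult_le)
    also have "\<dots> \<le> set_onorm (set_power S m) * set_onorm (set_power S n)"
      using BC assms by (intro mult_mono onorm_le_set_onorm set_onorm_set_power_nonneg onorm_pos_le) auto
    finally show ?thesis .
  qed
  thus ?thesis
    using assms by (subst (1) set_onorm_def, intro cSup_least) (auto simp: set_onorm_set_power_nonneg)
qed

text \<open>Since the radius is defined by \<open>lim\<close>, convergence has to be known before
  anything can be said about it. Growth at every rate above the radius is what both the upper bound
  on eigenvalues and the adapted norm rest on.\<close>

lemma joint_spectral_radius_props:
  fixes S :: "(complex^'d^'d) set"
  assumes "bounded S"
  shows joint_spectral_radius_nonneg: "joint_spectral_radius S \<ge> 0"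
    and joint_spectral_radius_power_le: "n \<noteq> 0 \<Longrightarrow> joint_spectral_radius S ^ n \<le> set_onorm (set_power S n)"
    and joint_spectral_radius_growth:
      "joint_spectral_radius S < t \<Longrightarrow> \<exists>C. \<forall>n. set_onorm (set_power S n) \<le> C * t ^ n"
proof -
  obtain L where L: "(\<lambda>n. root n (set_onorm (set_power S n))) \<longlonglongrightarrow> L" "L \<ge> 0"
    "\<And>n. L ^ n \<le> set_onorm (set_power S n) \<or> n = 0"
    "\<And>t. L < t \<Longrightarrow> \<exists>C. \<forall>n. set_onorm (set_power S n) \<le> C * t ^ n"
    using submultiplicative_growth[of "\<lambda>n. set_onorm (set_power S n)"]
      set_onorm_set_power_nonneg[OF assms] set_onorm_set_power_submult[OF assms] by metis
  have "joint_spectral_radius S = L"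
    unfolding joint_spectral_radius_def by (rule limI[OF L(1)])
  thus "joint_spectral_radius S \<ge> 0"
    "n \<noteq> 0 \<Longrightarrow> joint_spectral_radius S ^ n \<le> set_onorm (set_power S n)"
    "joint_spectral_radius S < t \<Longrightarrow> \<exists>C. \<forall>n. set_onorm (set_power S n) \<le> C * t ^ n"
    using L by blast+
qed

section \<open>Upper bound for eigenvalues of products\<close>

lemma norm_set_power_le:
  assumes "bounded S" "A \<in> set_power S n"
  shows "norm (A *v v) \<le> set_onorm (set_power S n) * norm v"
proof -
  have "norm (A *v v) \<le> onorm ((*v) A) * norm v" by (rule onorm) simp
  also have "\<dots> \<le> set_onorm (set_power S n) * norm v"
    using assms by (intro mult_right_mono onorm_le_set_onorm) auto
  finally show ?thesis .
qed

text \<open>The k-th power of \<open>A\<close> lies in \<open>set_power S (k * n)\<close> and scales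
  an eigenvector by \<open>c ^ k\<close>. Growth at rate \<open>t\<close> then bounds
  \<open>(cmod c / t ^ n) ^ k\<close> uniformly in \<open>k\<close>, which excludes a base above
  1.\<close>

lemma max_eigenvalue_modulus_le_power:
  fixes S :: "(complex^'d^'d) set"
  assumes S: "bounded S" and A: "A \<in> set_power S n" and n: "n \<noteq> 0"
  shows "max_eigenvalue_modulus A \<le> joint_spectral_radius S ^ n"
proof -
  obtain c where c: "c \<in> eigenvalues A" "max_eigenvalue_modulus A = cmod c"
    by (rule max_eigenvalue_modulus_attained)
  obtain v where v: "v \<noteq> 0" "A *v v = c *s v" using c by (auto simp: eigenvalues_def)
  have powers: "\<exists>B\<in>set_power S (k * n). B *v v = c ^ k *s v" for k
  proof (induction k)
    case (Suc k)
    then obtain B where B: "B \<in> set_power S (k * n)" "B *v v = c ^ k *s v" by blast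
    have "(A ** B) *v v = c ^ Suc k *s v"
      by (simp add: matrix_vector_mul_assoc[symmetric] B vec.scale v vector_smult_assoc mult.commute)
    thus ?case using set_power_addI[OF A B(1)] by auto
  qed (simp add: set_power_0)
  \<comment> \<open>Taking n-th roots makes the bound linear in \<open>t\<close>, so that
    \<open>dense_ge\<close> lets \<open>t\<close> descend to the radius.\<close>
  have "root n (cmod c) \<le> t" if t: "joint_spectral_radius S < t" for t
  proof (rule ccontr)
    assume "\<not> ?thesis"
    moreover have "t > 0" using t joint_spectral_radius_nonneg[OF S] by simp
    ultimately have "t ^ n < root n (cmod c) ^ n"
      using n by (intro power_strict_mono) auto
    hence "1 < cmod c / t ^ n" using n \<open>t > 0\<close> by simp
    obtain C where C: "\<And>n. set_onorm (set_power S n) \<le> C * t ^ n"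
      using joint_spectral_radius_growth[OF S t] by blast
    obtain k where k: "C < (cmod c / t ^ n) ^ k"
      using real_arch_pow[OF \<open>1 < cmod c / t ^ n\<close>] by blast
    obtain B where B: "B \<in> set_power S (k * n)" "B *v v = c ^ k *s v" using powers by blast
    have "cmod c ^ k * norm v \<le> set_onorm (set_power S (k * n)) * norm v"
      using norm_set_power_le[OF S B(1), of v] by (simp add: B norm_vector_smult norm_power)
    hence "cmod c ^ k \<le> C * t ^ (k * n)"
      using v(1) C[of "k * n"] by simp
    hence "(cmod c / t ^ n) ^ k \<le> C"
      using \<open>t > 0\<close> by (simp add: power_divide power_mult[symmetric] mult.commute divide_simps)
    thus False using k by simp
  qed
  hence "root n (cmod c) \<le> joint_spectral_radius S" by (rule dense_ge)
  hence "root n (cmod c) ^ n \<le> joint_spectral_radius S ^ n"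
    by (intro power_mono real_root_ge_zero) auto
  thus ?thesis using n by (simp add: c)
qed

section \<open>Norms adapted to a rate above the radius\<close>

lemma adapted_norm:
  fixes S :: "(complex^'d^'d) set"
  assumes S: "bounded S" and t: "joint_spectral_radius S < t"
  obtains N :: "complex^'d \<Rightarrow> real" and C where
    "\<And>x y. N (x + y) \<le> N x + N y" "\<And>c x. N (c *s x) = cmod c * N x"
    "\<And>x. norm x \<le> N x" "\<And>x. N x \<le> C * norm x"
    "\<And>n A x. A \<in> set_power S n \<Longrightarrow> N (A *v x) \<le> t ^ n * N x"
proof -
  have "t > 0" using t joint_spectral_radius_nonneg[OF S] by simp
  obtain C where C: "\<And>n. set_onorm (set_power S n) \<le> C * t ^ n"
    using joint_spectral_radius_growth[OF S t] by blast
  \<comment> \<open>The index \<open>n = 0\<close> contributes the Euclidean norm itself. Applying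
    \<open>A\<close> from \<open>set_power S m\<close> first only moves to products longer by
    \<open>m\<close>, which costs the factor \<open>t ^ m\<close>.\<close>
  define N where "N x = (SUP (n, A) \<in> (SIGMA n:UNIV. set_power S n). norm (A *v x) / t ^ n)" for x :: "complex^'d"
  have ne: "(SIGMA n:UNIV. set_power S n) \<noteq> {}" using set_power_0 by blast
  have bound: "norm (A *v x) / t ^ n \<le> C * norm x" if "A \<in> set_power S n" for n A x
  proof -
    have "norm (A *v x) \<le> C * t ^ n * norm x"
      using norm_set_power_le[OF S that, of x] mult_right_mono[OF C[of n] norm_ge_zero[of x]] by simp
    thus ?thesis using \<open>t > 0\<close> by (simp add: divide_simps mult_ac)
  qed
  have N_ge: "norm (A *v x) / t ^ n \<le> N x" if "A \<in> set_power S n" for n A x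
    unfolding N_def using that bound
    by (intro cSUP_upper2[where x = "(n, A)"] bdd_aboveI[of _ "C * norm x"]) auto
  have N_least: "N x \<le> b" if "\<And>n A. A \<in> set_power S n \<Longrightarrow> norm (A *v x) / t ^ n \<le> b" for x b
    unfolding N_def using that ne by (intro cSUP_least) auto
  have scale_le: "N (c *s x) \<le> cmod c * N x" for c x
  proof (rule N_least)
    fix n A assume "A \<in> set_power S n"
    from mult_left_mono[OF N_ge[OF this, of x], of "cmod c"]
    show "norm (A *v (c *s x)) / t ^ n \<le> cmod c * N x"
      by (simp add: vec.scale norm_vector_smult)
  qed
  have lower: "norm x \<le> N x" for x
    using N_ge[of "mat 1" 0 x] by (simp add: set_power_0)
  have upper: "N x \<le> C * norm x" for x
    by (rule N_least) (rule bound)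
  show ?thesis
  proof (rule that)
    fix x y
    show "N (x + y) \<le> N x + N y"
    proof (rule N_least)
      fix n A assume A: "A \<in> set_power S n"
      have "norm (A *v (x + y)) / t ^ n \<le> norm (A *v x) / t ^ n + norm (A *v y) / t ^ n"
        using \<open>t > 0\<close> by (simp add: matrix_vector_right_distrib norm_triangle_ineq divide_right_mono flip: add_divide_distrib)
      thus "norm (A *v (x + y)) / t ^ n \<le> N x + N y"
        using N_ge[OF A, of x] N_ge[OF A, of y] by simp
    qed
  next
    fix c x
    show "N (c *s x) = cmod c * N x"
    proof (cases "c = 0")
      case True
      thus ?thesis using lower[of 0] upper[of 0] by simp
    next
      case False
      \<comment> \<open>The reverse inequality is \<open>scale_le\<close> for the inverse
        scalar.\<close>
      have "N x = N (inverse c *s (c *s x))" using False by (simp add: vector_smult_assoc)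
      also have "\<dots> \<le> cmod (inverse c) * N (c *s x)" by (rule scale_le)
      finally have "cmod c * N x \<le> N (c *s x)"
        using mult_left_mono[of "N x" "cmod (inverse c) * N (c *s x)" "cmod c"] False
        by (simp add: norm_inverse flip: mult.assoc)
      thus ?thesis using scale_le[of c x] by simp
    qed
  next
    fix m A x assume A: "A \<in> set_power S m"
    show "N (A *v x) \<le> t ^ m * N x"
    proof (rule N_least)
      fix n B assume "B \<in> set_power S n"
      hence "norm (B ** A *v x) / t ^ (n + m) \<le> N x" using A by (intro N_ge set_power_addI)
      thus "norm (B *v (A *v x)) / t ^ n \<le> t ^ m * N x"
        using \<open>t > 0\<close> by (simp add: matrix_vector_mul_assoc power_add field_simps)
    qed
  qed (use lower upper in auto)
qed

text \<open>Otherwise products of length \<open>k * n\<close> would have norm at most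
  \<open>C * (\<rho> ^ n / 2) ^ k\<close>, while their supremum is at least
  \<open>\<rho> ^ (k * n)\<close>. This would give \<open>2 ^ k \<le> C\<close> for all positive
  \<open>k\<close>.\<close>

lemma norm_expanding_product:
  fixes S :: "(complex^'d^'d) set" and N :: "complex^'d \<Rightarrow> real"
  assumes S: "bounded S" and pos: "joint_spectral_radius S > 0"
    and lower: "\<And>x. norm x \<le> N x" and upper: "\<And>x. N x \<le> C * norm x" and n: "n \<noteq> 0"
  obtains A x where "A \<in> set_power S n" "joint_spectral_radius S ^ n / 2 * N x < N (A *v x)"
proof (rule ccontr)
  note expanding = that
  define \<rho> where "\<rho> = joint_spectral_radius S"
  assume "\<not> thesis"
  hence le: "N (A *v x) \<le> \<rho> ^ n / 2 * N x" if "A \<in> set_power S n" for A x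
    unfolding \<rho>_def using expanding[OF that, of x] by (metis not_less)
  have iter: "N (A *v x) \<le> (\<rho> ^ n / 2) ^ k * N x" if "A \<in> set_power S (k * n)" for k A x
    using that
  proof (induction k arbitrary: A)
    case (Suc k)
    then obtain B D where BD: "B \<in> set_power S n" "D \<in> set_power S (k * n)" "A = B ** D"
      by (auto elim: set_power_addE)
    have "N (A *v x) \<le> \<rho> ^ n / 2 * N (D *v x)"
      using le[OF BD(1)] by (simp add: BD(3) matrix_vector_mul_assoc[symmetric])
    also have "\<dots> \<le> \<rho> ^ n / 2 * ((\<rho> ^ n / 2) ^ k * N x)"
      using Suc.IH[OF BD(2)] pos by (intro mult_left_mono) (auto simp: \<rho>_def)
    finally show ?case by (simp add: mult.assoc)
  qed (simp add: set_power_0)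
  have C_nonneg: "C \<ge> 0"
    using lower[of "axis undefined 1"] upper[of "axis undefined 1"] by (simp add: norm_axis)
  have C_ge: "(2::real) ^ k \<le> C" if "k \<noteq> 0" for k
  proof -
    have "onorm ((*v) A) \<le> (\<rho> ^ n / 2) ^ k * C" if "A \<in> set_power S (k * n)" for A
    proof (rule onorm_le)
      fix x
      have "norm (A *v x) \<le> N (A *v x)" by (rule lower)
      also have "\<dots> \<le> (\<rho> ^ n / 2) ^ k * N x" using that by (rule iter)
      also have "\<dots> \<le> (\<rho> ^ n / 2) ^ k * (C * norm x)"
        using upper pos by (intro mult_left_mono) (auto simp: \<rho>_def)
      finally show "norm (A *v x) \<le> (\<rho> ^ n / 2) ^ k * C * norm x" by (simp add: mult.assoc)
    qed
    hence "set_onorm (set_power S (k * n)) \<le> (\<rho> ^ n / 2) ^ k * C"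
      unfolding set_onorm_def using C_nonneg pos by (intro cSup_least) (auto simp: \<rho>_def)
    moreover have "\<rho> ^ (k * n) \<le> set_onorm (set_power S (k * n))"
      using joint_spectral_radius_power_le[OF S] n that by (simp add: \<rho>_def)
    ultimately have "\<rho> ^ (k * n) \<le> (\<rho> ^ n / 2) ^ k * C" by simp
    also have "\<dots> = \<rho> ^ (k * n) * (C / 2 ^ k)"
      by (simp add: power_divide power_mult[symmetric] mult.commute)
    finally show ?thesis using pos by (simp add: \<rho>_def field_simps)
  qed
  \<comment> \<open>\<open>C_ge\<close> needs a nonzero exponent, hence the passage to
    \<open>Suc k\<close>.\<close>
  obtain k where k: "C < 2 ^ k" using real_arch_pow[of 2 C] by auto
  moreover have "(2::real) ^ k \<le> 2 ^ Suc k" by simp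
  ultimately show False using C_ge[of "Suc k"] by linarith
qed

text \<open>The order of choices avoids circularity: \<epsilon> and \<open>M\<close> depend only on
  the dimension and \<eta>, then come \<open>n\<close>, \<open>t\<close>, and finally
  \<open>N\<close> with its basis \<open>B\<close>. The Auerbach constants depend on the dimension
  alone, so they are available at the start. The free lower bound \<open>m\<close> yields
  arbitrarily long products.\<close>

lemma product_with_large_eigenvalue:
  fixes S :: "(complex^'d^'d) set"
  assumes S: "bounded S" and pos: "joint_spectral_radius S > 0" and "\<eta> > 0" and "m > 0"
  obtains l A where "l \<ge> m" "A \<in> set_power S l"
    "(1 - \<eta>) * joint_spectral_radius S ^ l \<le> max_eigenvalue_modulus A"
proof -
  define \<rho> where "\<rho> = joint_spectral_radius S"
  define D where "D = real CARD('d)"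
  have "\<rho> > 0" "D > 0" using pos by (simp_all add: \<rho>_def D_def)
  have "1 / (4 * D) > 0" using \<open>D > 0\<close> by simp
  \<comment> \<open>The bounds on \<open>x\<close> come from \<open>N\<close>-lengths between 1/4
    and 2, distorted by at most the factor \<open>D\<close>; the entry bound
    \<open>2 * D\<^sup>2\<close> is the one proved below for \<open>U\<close>.\<close>
  obtain \<epsilon> where \<epsilon>: "\<epsilon> > 0"
    "\<And>A (x :: complex^'d). \<lbrakk>\<And>i j. cmod (A $ i $ j) \<le> 2 * D\<^sup>2; 1 / (4 * D) \<le> norm x; norm x \<le> 2 * D;
       norm (A *v x - x) < \<epsilon>\<rbrakk> \<Longrightarrow> \<exists>\<mu>\<in>eigenvalues A. cmod (\<mu> - 1) < \<eta>"
    by (rule eigenvalue_near_one[OF \<open>1 / (4 * D) > 0\<close> \<open>\<eta> > 0\<close>, of "2 * D\<^sup>2" "2 * D", where 'd = 'd]) (rule that; blast)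
  obtain M :: nat where M: "\<forall>x. (\<forall>i\<le>M. x i \<in> cball (0 :: complex^'d) (2 * D)) \<longrightarrow>
      (\<exists>i j. i < j \<and> j \<le> M \<and> dist (x i) (x j) < \<epsilon>)"
    using compact_pigeonhole[OF compact_cball \<epsilon>(1)] by blast
  \<comment> \<open>This leaves room for the \<open>M + 1\<close> sampling positions
    \<open>m * i\<close>; distinct ones are at least \<open>m\<close> apart.\<close>
  define n where "n = m * Suc M"
  have "n > 0" using \<open>m > 0\<close> by (simp add: n_def)
  \<comment> \<open>Chosen so that \<open>t ^ n = 2 * \<rho> ^ n\<close> while \<open>t\<close> is
    strictly above \<rho>; every shorter power then also loses at most a factor 2.\<close>
  define t where "t = \<rho> * root n 2"
  have root2: "root n 2 > 1" using \<open>n > 0\<close> by simp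
  hence "t > \<rho>" using \<open>\<rho> > 0\<close> by (simp add: t_def)
  have t_pow: "t ^ k \<le> 2 * \<rho> ^ k" if "k \<le> n" for k
  proof -
    have "root n 2 ^ k \<le> root n 2 ^ n" using that root2 by (intro power_increasing) auto
    also have "\<dots> = 2" using \<open>n > 0\<close> by simp
    finally show ?thesis using \<open>\<rho> > 0\<close> by (simp add: t_def power_mult_distrib mult.commute)
  qed
  obtain N :: "complex^'d \<Rightarrow> real" and C where N:
    "\<And>x y. N (x + y) \<le> N x + N y" "\<And>c x. N (c *s x) = cmod c * N x"
    "\<And>x. norm x \<le> N x" "\<And>x. N x \<le> C * norm x"
    "\<And>n A x. A \<in> set_power S n \<Longrightarrow> N (A *v x) \<le> t ^ n * N x"
    using adapted_norm[OF S] \<open>t > \<rho>\<close> unfolding \<rho>_def by blast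
  have N_nonneg: "N x \<ge> 0" for x using N(3)[of x] norm_ge_zero[of x] by linarith
  obtain B :: "complex^'d^'d" where B: "invertible B" "\<And>x. N (B *v x) \<le> D * norm x" "\<And>x. norm x \<le> D * N (B *v x)"
    using auerbach_basis[OF N(1-4)] unfolding D_def by blast
  obtain B' where B': "B ** B' = mat 1" "B' ** B = mat 1"
    using B(1) by (auto simp: invertible_def)
  have BB': "B *v (B' *v x) = x" for x by (simp add: matrix_vector_mul_assoc B')

  obtain A x where A: "A \<in> set_power S n" and Ax: "\<rho> ^ n / 2 * N x < N (A *v x)"
    using norm_expanding_product[OF S pos N(3,4)] \<open>n > 0\<close> unfolding \<rho>_def by blast
  have "x \<noteq> 0"
    using Ax N(2)[of 0 0] by auto
  hence "N x > 0" using N(3)[of x] by (meson less_le_trans zero_less_norm_iff)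
  obtain ss where ss: "A = foldr (**) ss (mat 1)" "length ss = n" "set ss \<subseteq> S"
    using A by (auto simp: set_power_def)
  \<comment> \<open>Factors act from the right end of the list, so time runs with decreasing index:
    \<open>z n\<close> is the start \<open>x\<close> and \<open>z 0\<close> is
    \<open>A *v x\<close>. The block \<open>P a b\<close> carries \<open>z b\<close> to
    \<open>z a\<close>.\<close>
  define z where "z b = foldr (**) (drop b ss) (mat 1) *v x" for b
  define P where "P a b = foldr (**) (take (b - a) (drop a ss)) (mat 1)" for a b
  have P: "P a b \<in> set_power S (b - a)" if "a \<le> b" "b \<le> n" for a b
    using that ss set_take_subset[of "b - a" "drop a ss"] set_drop_subset[of a ss]
    by (force simp: P_def set_power_def)
  have z: "z a = P a b *v z b" if "a \<le> b" for a b
  proof -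
    have "drop a ss = take (b - a) (drop a ss) @ drop b ss"
      using that by (metis append_take_drop_id drop_drop le_add_diff_inverse2)
    thus ?thesis
      unfolding z_def P_def
      by (metis foldr_matrix_mult_append matrix_vector_mul_assoc)
  qed
  have z_n: "z n = x" and z_0: "z 0 = A *v x" by (simp_all add: z_def ss)
  \<comment> \<open>The images of \<open>x\<close>, divided by the growth expected after
    \<open>n - b\<close> factors and written in the basis \<open>B\<close>.\<close>
  define w where "w b = B' *v (of_real (1 / (\<rho> ^ (n - b) * N x)) *s z b)" for b
  have N_w: "N (B *v w b) = N (z b) / (\<rho> ^ (n - b) * N x)" for b
    using \<open>\<rho> > 0\<close> \<open>N x > 0\<close> by (simp add: w_def BB' N(2) norm_divide norm_mult norm_power)
  have N_w_le: "N (B *v w b) \<le> 2" if "b \<le> n" for b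
  proof -
    have "N (z b) \<le> t ^ (n - b) * N x"
      using N(5)[OF P, of b n x] z[of b n] z_n that by simp
    also have "\<dots> \<le> 2 * \<rho> ^ (n - b) * N x"
      using \<open>N x > 0\<close> by (intro mult_right_mono t_pow) auto
    finally show ?thesis
      using \<open>\<rho> > 0\<close> \<open>N x > 0\<close> by (simp add: N_w divide_simps mult_ac)
  qed
  \<comment> \<open>The remaining \<open>b\<close> factors expand by at most
    \<open>2 * \<rho> ^ b\<close>, yet the whole product expands by at least
    \<open>\<rho> ^ n / 2\<close>; so at least a quarter of the expected growth is already present
    at \<open>b\<close>.\<close>
  have N_w_ge: "1 / 4 \<le> N (B *v w b)" if "b \<le> n" for b
  proof -
    have "\<rho> ^ n / 2 * N x \<le> N (z 0)" using Ax z_0 by simp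
    also have "\<dots> \<le> t ^ b * N (z b)"
      using N(5)[OF P, of 0 b "z b"] z[of 0 b] that by simp
    also have "\<dots> \<le> 2 * \<rho> ^ b * N (z b)"
      using N_nonneg by (intro mult_right_mono t_pow that)
    also have "\<rho> ^ n = \<rho> ^ b * \<rho> ^ (n - b)"
      using that by (simp flip: power_add)
    finally show ?thesis
      using \<open>\<rho> > 0\<close> \<open>N x > 0\<close> by (simp add: N_w divide_simps mult_ac)
  qed
  have w_le: "norm (w b) \<le> 2 * D" if "b \<le> n" for b
    using order_trans[OF B(3)[of "w b"] mult_left_mono[OF N_w_le[OF that], of D]] \<open>D > 0\<close>
    by (simp add: mult.commute)
  have w_ge: "1 / (4 * D) \<le> norm (w b)" if "b \<le> n" for b
    using B(2)[of "w b"] N_w_ge[OF that] \<open>D > 0\<close> by (simp add: divide_simps mult_ac)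
  have le_n: "m * i \<le> n" if "i \<le> M" for i
    unfolding n_def using that by (intro mult_le_mono2) simp
  obtain i j where ij: "i < j" "j \<le> M" "dist (w (m * i)) (w (m * j)) < \<epsilon>"
    using M[rule_format, of "\<lambda>i. w (m * i)"] w_le le_n by auto
  define a b l where "a = m * i" and "b = m * j" and "l = b - a"
  have ab: "a \<le> b" "b \<le> n" "a \<le> n" using ij le_n by (auto simp: a_def b_def)
  have "l = m * (j - i)" by (simp add: l_def a_def b_def diff_mult_distrib2)
  hence "l \<ge> m" using ij(1) by (simp add: Suc_le_eq)
  have Pl: "P a b \<in> set_power S l" unfolding l_def by (rule P) fact+
  define s :: complex where "s = of_real (1 / \<rho> ^ l)"
  have norm_s: "cmod s = 1 / \<rho> ^ l" using \<open>\<rho> > 0\<close> by (simp add: s_def norm_divide norm_power)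
  \<comment> \<open>The block between the two close positions, normalised by
    \<open>\<rho> ^ l\<close> and conjugated by \<open>B\<close>: it sends \<open>w b\<close> to the
    nearby \<open>w a\<close>, and its eigenvalues times \<open>\<rho> ^ l\<close> are eigenvalues
    of the block.\<close>
  define U where "U = B' ** (mat s ** P a b) ** B"
  have U: "U *v y = B' *v (s *s (P a b *v (B *v y)))" for y
    by (simp add: U_def mat_vector_mult flip: matrix_vector_mul_assoc)
  have U_w: "U *v w b = w a"
  proof -
    have "n - a = (n - b) + l" using ab by (simp add: l_def)
    hence "s * of_real (1 / (\<rho> ^ (n - b) * N x)) = of_real (1 / (\<rho> ^ (n - a) * N x))"
      by (simp add: s_def power_add)
    hence "s *s (of_real (1 / (\<rho> ^ (n - b) * N x)) *s z a) = of_real (1 / (\<rho> ^ (n - a) * N x)) *s z a"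
      by (simp only: vector_smult_assoc)
    moreover have "U *v w b = B' *v (s *s (of_real (1 / (\<rho> ^ (n - b) * N x)) *s z a))"
      unfolding U w_def[of b] BB' z[OF ab(1)] by (simp only: vec.scale)
    ultimately show ?thesis by (simp only: w_def)
  qed
  \<comment> \<open>Each passage between \<open>N\<close> and the Euclidean norm costs a factor
    \<open>D\<close>, and \<open>t ^ l\<close> against \<open>\<rho> ^ l\<close> costs 2.\<close>
  have U_bound: "norm (U *v y) \<le> 2 * D\<^sup>2 * norm y" for y
  proof -
    have "norm (U *v y) \<le> D * N (B *v (U *v y))" by (rule B)
    also have "N (B *v (U *v y)) = N (P a b *v (B *v y)) / \<rho> ^ l"
      unfolding U BB' N(2) norm_s by simp
    also have "\<dots> \<le> (2 * \<rho> ^ l * (D * norm y)) / \<rho> ^ l"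
    proof (intro divide_right_mono)
      have "N (P a b *v (B *v y)) \<le> t ^ l * N (B *v y)" using Pl by (rule N)
      also have "\<dots> \<le> 2 * \<rho> ^ l * (D * norm y)"
        using B(2) N_nonneg \<open>\<rho> > 0\<close> ab by (intro mult_mono t_pow) (auto simp: l_def)
      finally show "N (P a b *v (B *v y)) \<le> 2 * \<rho> ^ l * (D * norm y)" .
    qed (use \<open>\<rho> > 0\<close> in auto)
    finally show ?thesis
      using \<open>\<rho> > 0\<close> \<open>D > 0\<close> by (simp add: power2_eq_square mult_ac)
  qed
  have U_entry: "cmod (U $ p $ q) \<le> 2 * D\<^sup>2" for p q
  proof -
    have "U $ p $ q = (U *v axis q 1) $ p"
      by (simp add: matrix_vector_mult_def axis_def if_distrib cong: if_cong)
    hence "cmod (U $ p $ q) \<le> norm (U *v axis q 1)"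
      using Finite_Cartesian_Product.norm_nth_le by metis
    also have "\<dots> \<le> 2 * D\<^sup>2" using U_bound[of "axis q 1"] by (simp add: norm_axis)
    finally show ?thesis .
  qed
  have "norm (U *v w b - w b) < \<epsilon>"
    using ij(3) unfolding U_w by (simp add: a_def b_def dist_norm)
  then obtain \<mu> where \<mu>: "\<mu> \<in> eigenvalues U" "cmod (\<mu> - 1) < \<eta>"
    using \<epsilon>(2)[OF U_entry w_ge w_le] ab by blast
  then obtain y where y: "y \<noteq> 0" "U *v y = \<mu> *s y" by (auto simp: eigenvalues_def)
  have "B *v y \<noteq> 0" using y(1) B' by (metis matrix_left_invertible_ker)
  have "s *s (P a b *v (B *v y)) = \<mu> *s (B *v y)"
    using arg_cong[OF y(2), of "(*v) B"] by (simp add: U BB' vec.scale)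
  hence "of_real (\<rho> ^ l) *s (s *s (P a b *v (B *v y))) = (of_real (\<rho> ^ l) * \<mu>) *s (B *v y)"
    by (simp add: vector_smult_assoc)
  hence "P a b *v (B *v y) = (of_real (\<rho> ^ l) * \<mu>) *s (B *v y)"
    using \<open>\<rho> > 0\<close> by (simp add: s_def vector_smult_assoc)
  hence "of_real (\<rho> ^ l) * \<mu> \<in> eigenvalues (P a b)"
    using \<open>B *v y \<noteq> 0\<close> by (auto simp: eigenvalues_def)
  hence "\<rho> ^ l * cmod \<mu> \<le> max_eigenvalue_modulus (P a b)"
    using cmod_le_max_eigenvalue_modulus[of "of_real (\<rho> ^ l) * \<mu>"] \<open>\<rho> > 0\<close>
    by (simp add: norm_mult norm_power)
  moreover have "1 - \<eta> \<le> cmod \<mu>"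
    using \<mu>(2) norm_triangle_ineq2[of 1 \<mu>] by (simp add: norm_minus_commute)
  hence "(1 - \<eta>) * \<rho> ^ l \<le> \<rho> ^ l * cmod \<mu>"
    using \<open>\<rho> > 0\<close> by (simp add: mult.commute)
  ultimately show ?thesis
    using that[OF \<open>l \<ge> m\<close> Pl] by (simp add: \<rho>_def)
qed

section \<open>The limit superior\<close>

theorem theorem2:
  fixes S :: "(complex^'d^'d) set"
  assumes "bounded S"
    and "joint_spectral_radius S > 0"
  shows "limsup (\<lambda>n. ereal (set_max_eigenvalue_modulus (set_power S n) / joint_spectral_radius S ^ n)) = 1"
proof -
  define \<rho> where "\<rho> = joint_spectral_radius S"
  have "\<rho> > 0" using assms by (simp add: \<rho>_def)
  define f where "f n = set_max_eigenvalue_modulus (set_power S n) / \<rho> ^ n" for n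
  have "f n \<le> 1" if "n \<ge> 1" for n
  proof -
    have "set_max_eigenvalue_modulus (set_power S n) \<le> \<rho> ^ n"
      unfolding set_max_eigenvalue_modulus_def
      using max_eigenvalue_modulus_le_power[OF assms(1)] that \<open>\<rho> > 0\<close>
      by (intro cSup_least) (auto simp: \<rho>_def)
    thus ?thesis using \<open>\<rho> > 0\<close> by (simp add: f_def)
  qed
  hence "\<forall>\<^sub>F n in sequentially. ereal (f n) \<le> 1"
    by (auto simp: eventually_sequentially)
  hence "limsup (\<lambda>n. ereal (f n)) \<le> 1" by (rule Limsup_bounded)
  moreover have "1 \<le> limsup (\<lambda>n. ereal (f n))"
  proof (rule ereal_le_epsilon2)
    fix \<eta> :: real assume "\<eta> > 0"
    have "\<exists>l\<ge>m. ereal (1 - \<eta>) \<le> ereal (f l)" for m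
    proof -
      have "max m 1 > 0" by simp
      then obtain l A where l: "l \<ge> max m 1" and A: "A \<in> set_power S l"
        "(1 - \<eta>) * \<rho> ^ l \<le> max_eigenvalue_modulus A"
        using product_with_large_eigenvalue[OF assms \<open>\<eta> > 0\<close>] unfolding \<rho>_def by blast
      \<comment> \<open>The upper bound on eigenvalues is used again here, to make the supremum
        finite.\<close>
      have "max_eigenvalue_modulus A \<le> set_max_eigenvalue_modulus (set_power S l)"
        unfolding set_max_eigenvalue_modulus_def
        using A(1) l max_eigenvalue_modulus_le_power[OF assms(1)] \<open>\<rho> > 0\<close>
        by (intro cSup_upper bdd_aboveI[of _ "\<rho> ^ l"]) (auto simp: \<rho>_def)
      hence "1 - \<eta> \<le> f l" using A(2) \<open>\<rho> > 0\<close> by (simp add: f_def pos_le_divide_eq)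
      thus ?thesis using l by auto
    qed
    hence "ereal (1 - \<eta>) \<le> limsup (\<lambda>n. ereal (f n))"
      unfolding limsup_INF_SUP by (intro INF_greatest) (meson SUP_upper2 atLeast_iff)
    thus "1 \<le> limsup (\<lambda>n. ereal (f n)) + ereal \<eta>"
      by (cases "limsup (\<lambda>n. ereal (f n))") (auto simp: one_ereal_def)
  qed
  ultimately show ?thesis unfolding f_def \<rho>_def by (rule antisym)
qed

end
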